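(* Let $G$ be a graph on vertices $1,\dots,n$ and $K=K(G)$. Let $\mathbf{v}$ be a vector in $\mathbb{C}^{2n}$ and let $\lambda\neq0$. The vector $\mathbf{v}$ is an eigenvector of $K$ for the eigenvalue $\lambda$ if and only if $$\mathbf{v}_{n+i}=\frac{-\mathbf{v}_i}{\lambda}\quad\text{and}\quad \sum_{j\sim i}\mathbf{v}_j=\mathbf{v}_i\frac1\lambda\left(\deg(i)-1+\lambda^2\right)$$ for all $1\le i\le n$.
   Context: All graphs are finite, simple and connected. With $A$ the adjacency matrix and $D$ the diagonal degree matrix of $G$, $K(G)$ is the $2n\times2n$ matrix $\begin{bmatrix} A & D-I_n\\ -I_n & 0\end{bmatrix}$. Here $\mathbf{v}_i$ is the $i$th entry of $\mathbf{v}$, $j\sim i$ means that vertices $i,j\in\{1,\dots,n\}$ are adjacent, and $\deg(i)$ is the degree of $i$. *)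

theory Defs
  imports "Graph_Theory.Digraph_Component" "Jordan_Normal_Form.Char_Poly"
begin

text \<open>
  Finite simple graphs are the symmetric digraphs of the locale \<^locale>\<open>graph\<close>: an edge between
  i and j is a pair of opposite arcs, so adjacency is \<open>i \<rightarrow>\<^bsub>G\<^esub> j\<close> and the degree of i is its
  out-degree. The vertices are 1, ..., n, whereas matrices and vectors are indexed from 0: row
  and column i of a matrix belong to the vertex \<open>Suc i\<close>.
\<close>

abbreviation num_verts :: "(nat, 'b) pre_digraph \<Rightarrow> nat" where
  "num_verts G \<equiv> card (verts G)"

definition adjacency_mat :: "(nat, 'b) pre_digraph \<Rightarrow> complex mat" where
  "adjacency_mat G =
     mat (num_verts G) (num_verts G) (\<lambda>(i, j). if Suc i \<rightarrow>\<^bsub>G\<^esub> Suc j then 1 else 0)"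

definition degree_mat :: "(nat, 'b) pre_digraph \<Rightarrow> complex mat" where
  "degree_mat G = mat_diag (num_verts G) (\<lambda>i. of_nat (out_degree G (Suc i)))"

definition K_mat :: "(nat, 'b) pre_digraph \<Rightarrow> complex mat" where
  "K_mat G =
     four_block_mat (adjacency_mat G)       (degree_mat G - 1\<^sub>m (num_verts G))
                    (- 1\<^sub>m (num_verts G))   (0\<^sub>m (num_verts G) (num_verts G))"

text \<open>The i-th entry of a vector, counted from 1; meaningful only for i at least 1.\<close>

abbreviation entry :: "complex vec \<Rightarrow> nat \<Rightarrow> complex" where
  "entry v i \<equiv> v $ (i - 1)"

end

theory Submission
  imports Defs
begin

text \<open>
  Write \<open>v = (u, w)\<close> with \<open>u\<close> the first and \<open>w\<close> the last \<open>n\<close> entries. By the block form of \<open>K\<close>,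
  \<open>K v = (A u + (D - I) w, - u)\<close> (\<open>K_mat_mult_append_vec\<close>), so for a nonzero \<open>v\<close> being an
  eigenvector means \<open>A u + (D - I) w = lam u\<close> and \<open>- u = lam w\<close>. As \<open>lam \<noteq> 0\<close>, the second equation
  says \<open>w = - u / lam\<close>. Substituting this into the first gives
  \<open>A u = lam u + (D - I) u / lam\<close>, which is the claimed condition read off at each vertex, because
  \<open>A u\<close> sums \<open>u\<close> over neighbours (\<open>adjacency_mat_mult_vec_index\<close>).
\<close>

lemma mat_diag_mult_vec_index:
  assumes "w \<in> carrier_vec n" "i < n"
  shows "(mat_diag n f *\<^sub>v w) $ i = f i * w $ i"
  using assms by (simp add: mat_diag_def scalar_prod_def if_distrib[of "\<lambda>x. x * _"] cong: if_cong)

text \<open>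
  A row of the adjacency matrix ranges over the arcs leaving \<open>Suc i\<close>; symmetry of the graph turns
  them into the arcs entering \<open>Suc i\<close>, and reindexing passes from positions, which start at 0, to
  vertices, which start at 1.
\<close>

lemma adjacency_mat_mult_vec_index:
  assumes "graph G" "verts G = {1..n}" "u \<in> carrier_vec n" "i < n"
  shows "(adjacency_mat G *\<^sub>v u) $ i = (\<Sum>j | j \<rightarrow>\<^bsub>G\<^esub> Suc i. entry u j)"
proof -
  interpret graph G by fact
  have "Suc i \<rightarrow>\<^bsub>G\<^esub> k \<longleftrightarrow> k \<rightarrow>\<^bsub>G\<^esub> Suc i" for k
    using graph_symmetric by blast
  then have "(adjacency_mat G *\<^sub>v u) $ i = (\<Sum>k = 0..<n. if Suc k \<rightarrow>\<^bsub>G\<^esub> Suc i then u $ k else 0)"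
    using assms(2-4)
    by (auto simp: adjacency_mat_def scalar_prod_def intro!: sum.cong)
  also have "\<dots> = (\<Sum>k | k < n \<and> Suc k \<rightarrow>\<^bsub>G\<^esub> Suc i. u $ k)"
    by (simp add: sum.If_cases Int_def atLeast0LessThan)
  also have "\<dots> = (\<Sum>j | j \<rightarrow>\<^bsub>G\<^esub> Suc i. entry u j)"
  proof (rule sum.reindex_bij_witness[where i = "\<lambda>j. j - 1" and j = Suc])
    fix j assume "j \<in> {j. j \<rightarrow>\<^bsub>G\<^esub> Suc i}"
    moreover from this have "j \<in> {1..n}"
      using adj_in_verts(1) assms(2) by blast
    ultimately show "Suc (j - 1) = j" and "j - 1 \<in> {k. k < n \<and> Suc k \<rightarrow>\<^bsub>G\<^esub> Suc i}"
      by auto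
  qed auto
  finally show ?thesis .
qed

lemma K_mat_mult_append_vec:
  assumes "verts G = {1..n}" "u \<in> carrier_vec n" "w \<in> carrier_vec n"
  shows "K_mat G *\<^sub>v (u @\<^sub>v w) = (adjacency_mat G *\<^sub>v u + (degree_mat G *\<^sub>v w - w)) @\<^sub>v (- u)"
proof -
  have n: "num_verts G = n" and A: "adjacency_mat G \<in> carrier_mat n n"
    and D: "degree_mat G \<in> carrier_mat n n"
    using assms(1) by (simp_all add: adjacency_mat_def degree_mat_def)
  have "K_mat G *\<^sub>v (u @\<^sub>v w)
      = (adjacency_mat G *\<^sub>v u + (degree_mat G - 1\<^sub>m n) *\<^sub>v w) @\<^sub>v (- 1\<^sub>m n *\<^sub>v u + 0\<^sub>m n n *\<^sub>v w)"
    unfolding K_mat_def n using A D assms(2,3) by (intro four_block_mat_mult_vec) auto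
  also have "(degree_mat G - 1\<^sub>m n) *\<^sub>v w = degree_mat G *\<^sub>v w - w"
    using D assms(3) by (simp add: minus_mult_distrib_mat_vec[of _ n n])
  also have "- 1\<^sub>m n *\<^sub>v u + 0\<^sub>m n n *\<^sub>v w = - u"
    using assms(2,3) by (intro eq_vecI) auto
  finally show ?thesis .
qed

theorem proposition3p1:
  fixes G :: "(nat, 'b) pre_digraph" and n :: nat and v :: "complex vec" and lam :: complex
  assumes "graph G" and "Digraph_Component.connected G" and "verts G = {1..n}"
    and "v \<in> carrier_vec (2 * n)" and "v \<noteq> 0\<^sub>v (2 * n)" and "lam \<noteq> 0"
  shows "eigenvector (K_mat G) v lam \<longleftrightarrow>
    (\<forall>i\<in>{1..n}.
       entry v (n + i) = - entry v i / lam \<and>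
       (\<Sum>j | j \<rightarrow>\<^bsub>G\<^esub> i. entry v j) =
         entry v i * (1 / lam) * (of_nat (out_degree G i) - 1 + lam\<^sup>2))"
proof -
  interpret graph G by fact
  note verts = \<open>verts G = {1..n}\<close>
  define u where "u = vec_first v n"
  define w where "w = vec_last v n"
  have u: "u \<in> carrier_vec n" and w: "w \<in> carrier_vec n"
    by (simp_all add: u_def w_def)
  have v: "v = u @\<^sub>v w"
    using assms(4) by (simp add: u_def w_def mult_2)
  have dims: "dim_row (K_mat G) = 2 * n"
    using verts by (simp add: K_mat_def adjacency_mat_def)
  \<comment> \<open>Neighbours are vertices, so a sum over them only meets the first half of \<open>v\<close>.\<close>
  have nbrs: "(\<Sum>j | j \<rightarrow>\<^bsub>G\<^esub> i. entry u j) = (\<Sum>j | j \<rightarrow>\<^bsub>G\<^esub> i. entry v j)" for i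
  proof (rule sum.cong[OF refl])
    fix j assume "j \<in> {j. j \<rightarrow>\<^bsub>G\<^esub> i}"
    then have "j \<in> {1..n}"
      using adj_in_verts(1) verts by blast
    then show "entry u j = entry v j"
      using u w by (auto simp: v)
  qed
  \<comment> \<open>The scalar core, with \<open>x\<close> and \<open>y\<close> standing for the \<open>i\<close>-th entries of \<open>u\<close> and \<open>w\<close>: the equation
    for \<open>y\<close> is solved first, and only under it are the two neighbour-sum equations equivalent.\<close>
  have coord: "(\<Sum>j | j \<rightarrow>\<^bsub>G\<^esub> i. entry v j) + (of_nat (out_degree G i) - 1) * y = lam * x
      \<and> - x = lam * y \<longleftrightarrow>
    y = - x / lam \<and> (\<Sum>j | j \<rightarrow>\<^bsub>G\<^esub> i. entry v j)
      = x * (1 / lam) * (of_nat (out_degree G i) - 1 + lam\<^sup>2)"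
    (is "?s + (?d - 1) * y = _ \<and> _ \<longleftrightarrow> _") for x y i
  proof -
    have "- x = lam * y \<longleftrightarrow> y = - x / lam"
      using \<open>lam \<noteq> 0\<close> by (auto simp: field_simps)
    moreover have "?s + (?d - 1) * y = lam * x \<longleftrightarrow> ?s = x * (1 / lam) * (?d - 1 + lam\<^sup>2)"
      if "y = - x / lam"
    proof -
      have eq: "lam * x - (?d - 1) * y = x * (1 / lam) * (?d - 1 + lam\<^sup>2)"
        using \<open>lam \<noteq> 0\<close> by (simp add: that field_simps power2_eq_square)
      then show ?thesis
        by (simp only: eq[symmetric] eq_diff_eq)
    qed
    ultimately show ?thesis by blast
  qed
  have "eigenvector (K_mat G) v lam \<longleftrightarrow> K_mat G *\<^sub>v v = lam \<cdot>\<^sub>v v"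
    using assms(4,5) by (simp add: eigenvector_def dims)
  also have "\<dots> \<longleftrightarrow> (adjacency_mat G *\<^sub>v u + (degree_mat G *\<^sub>v w - w)) @\<^sub>v (- u)
      = (lam \<cdot>\<^sub>v u) @\<^sub>v (lam \<cdot>\<^sub>v w)"
  proof -
    have "lam \<cdot>\<^sub>v (u @\<^sub>v w) = (lam \<cdot>\<^sub>v u) @\<^sub>v (lam \<cdot>\<^sub>v w)"
      by (rule eq_vecI) auto
    then show ?thesis
      by (simp add: v K_mat_mult_append_vec[OF verts u w])
  qed
  also have "\<dots> \<longleftrightarrow> adjacency_mat G *\<^sub>v u + (degree_mat G *\<^sub>v w - w) = lam \<cdot>\<^sub>v u \<and> - u = lam \<cdot>\<^sub>v w"
    using u w by (intro append_vec_eq[of _ n] carrier_vecI) simp_all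
  also have "\<dots> \<longleftrightarrow> (\<forall>i<n. (adjacency_mat G *\<^sub>v u + (degree_mat G *\<^sub>v w - w)) $ i = lam * u $ i
      \<and> - u $ i = lam * w $ i)"
    using u w by (auto simp: vec_eq_iff)
  also have "\<dots> \<longleftrightarrow> (\<forall>i<n. (\<Sum>j | j \<rightarrow>\<^bsub>G\<^esub> Suc i. entry v j)
        + (of_nat (out_degree G (Suc i)) - 1) * w $ i = lam * u $ i \<and> - u $ i = lam * w $ i)"
  proof -
    have "(adjacency_mat G *\<^sub>v u + (degree_mat G *\<^sub>v w - w)) $ i
        = (\<Sum>j | j \<rightarrow>\<^bsub>G\<^esub> Suc i. entry v j) + (of_nat (out_degree G (Suc i)) - 1) * w $ i"
      if "i < n" for i
    proof -
      have "(adjacency_mat G *\<^sub>v u + (degree_mat G *\<^sub>v w - w)) $ i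
          = (adjacency_mat G *\<^sub>v u) $ i + ((degree_mat G *\<^sub>v w) $ i - w $ i)"
        using u w verts that by (simp add: degree_mat_def)
      then show ?thesis
        using adjacency_mat_mult_vec_index[OF assms(1) verts u that, unfolded nbrs] w verts that
        by (simp add: degree_mat_def mat_diag_mult_vec_index algebra_simps)
    qed
    then show ?thesis by auto
  qed
  also have "\<dots> \<longleftrightarrow> (\<forall>i<n. w $ i = - u $ i / lam \<and> (\<Sum>j | j \<rightarrow>\<^bsub>G\<^esub> Suc i. entry v j)
      = u $ i * (1 / lam) * (of_nat (out_degree G (Suc i)) - 1 + lam\<^sup>2))"
    by (simp only: coord)
  also have "\<dots> \<longleftrightarrow> (\<forall>i\<in>Suc ` {..<n}. entry v (n + i) = - entry v i / lam \<and>
       (\<Sum>j | j \<rightarrow>\<^bsub>G\<^esub> i. entry v j) =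
         entry v i * (1 / lam) * (of_nat (out_degree G i) - 1 + lam\<^sup>2))"
  proof -
    have "entry v (Suc i) = u $ i" "entry v (n + Suc i) = w $ i" if "i < n" for i
      using u w that by (auto simp: v)
    then show ?thesis by auto
  qed
  also have "Suc ` {..<n} = {1..n}"
    by (simp add: image_Suc_lessThan)
  finally show ?thesis .
qed

end
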